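(* Consider the uniformly Lipschitz experts problem with full feedback on a metric space $(X,\mathcal{D})$. For each $b>\mathrm{LCD}(X)$ such that $b\ge2$, the algorithm $\mathrm{NaiveExp}(b-2)$ achieves regret $R(t)=O(t^{1-1/b})$.
   Context: Lipschitz experts problem on $(X,\mathcal{D})$ (diameter at most 1, known): an instance is an unknown Borel probability measure $\mathbb{P}$ on $[0,1]^X$ with $\mu(x)=\mathbb{E}_{f\sim\mathbb{P}}[f(x)]$ $1$-Lipschitz; each round the algorithm picks $x_t$, $f_t\sim\mathbb{P}$ is drawn independently, the algorithm receives $f_t(x_t)$ and may observe $f_t$ at any finite number of points. Uniformly Lipschitz: every $f$ in the support of $\mathbb{P}$ is $1$-Lipschitz on $(X,\mathcal{D})$. Regret $R(t)=t\sup\mu-\mathbb{E}[\sum_{s\le t}\mu(x_s)]$. $N_\delta(X)$: smallest number of sets of diameter at most $\delta$ covering $X$; $\mathrm{LCD}(X)=\limsup_{r\to0}\frac{\log\log N_r(X)}{\log(1/r)}$. $S$ is a $\delta$-hitting set for $X$ if $X\subseteq\bigcup_{x\in S}B(x,\delta)$. Algorithm $\mathrm{NaiveExp}(a)$: phases $i=1,2,\dots$, phase $i$ lasting $T=2^i$ rounds. In phase $i$ it picks a $\delta$-hitting set $S$ for $X$ of size at most $N_\delta(X)$ with $\delta=T^{-1/(a+2)}$, observes payoffs of all points of $S$ in each round, and at the end outputs $x_i^*\in S$ with the highest sample average (ties arbitrary); it plays $x_i^*$ throughout phase $i+1$. *)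

theory Defs
  imports "HOL-Probability.Probability"
begin

definition covering_number :: "'a::metric_space set \<Rightarrow> real \<Rightarrow> enat" where
  "covering_number X \<delta> =
     (INF \<C> \<in> {\<C>. finite \<C> \<and> (\<forall>A\<in>\<C>. bounded A \<and> diameter A \<le> \<delta>) \<and> X \<subseteq> \<Union>\<C>}. enat (card \<C>))"

(* Iterated logarithm with log log \<infinity> = \<infinity>, and log log 1 = log 0 = -\<infinity>. *)
definition loglog :: "enat \<Rightarrow> ereal" where
  "loglog N = (case N of enat n \<Rightarrow> if n \<le> 1 then -\<infinity> else ereal (ln (ln (real n))) | \<infinity> \<Rightarrow> \<infinity>)"

definition LCD :: "'a::metric_space set \<Rightarrow> ereal" where
  "LCD X = Limsup (at_right 0) (\<lambda>r. loglog (covering_number X r) / ereal (ln (1 / r)))"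

(* Closed balls: one point from each set of a minimal cover by sets of diameter at most \<delta> then
   gives a \<delta>-hitting set of size at most the covering number, which may fail for open balls. *)
definition hitting_set :: "'a::metric_space set \<Rightarrow> real \<Rightarrow> 'a set \<Rightarrow> bool" where
  "hitting_set X \<delta> S \<longleftrightarrow> S \<subseteq> X \<and> X \<subseteq> (\<Union>x\<in>S. cball x \<delta>)"

lemma hitting_set_exists:
  assumes "covering_number X \<delta> \<noteq> \<infinity>"
  shows "\<exists>S. finite S \<and> hitting_set X \<delta> S \<and> enat (card S) \<le> covering_number X \<delta>"
proof -
  let ?F = "{\<C>. finite \<C> \<and> (\<forall>A\<in>\<C>. bounded A \<and> diameter A \<le> \<delta>) \<and> X \<subseteq> \<Union>\<C>}"
  have "?F \<noteq> {}"
    using assms unfolding covering_number_def by (metis image_empty Inf_enat_def)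
  then have "covering_number X \<delta> \<in> (\<lambda>\<C>. enat (card \<C>)) ` ?F"
    unfolding covering_number_def by (metis (no_types, lifting) ex_in_conv image_is_empty wellorder_InfI)
  then obtain \<C> where C: "finite \<C>" "\<And>A. A \<in> \<C> \<Longrightarrow> bounded A \<and> diameter A \<le> \<delta>" "X \<subseteq> \<Union>\<C>"
    and card: "covering_number X \<delta> = enat (card \<C>)"
    by auto
  define D where "D = {A\<in>\<C>. A \<inter> X \<noteq> {}}"
  define p where "p A = (SOME x. x \<in> A \<inter> X)" for A
  have p: "p A \<in> A \<inter> X" if "A \<in> D" for A
    using that unfolding D_def p_def by (metis (mono_tags, lifting) ex_in_conv mem_Collect_eq someI_ex)
  have fin: "finite D" and "D \<subseteq> \<C>" using C(1) by (auto simp: D_def)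
  then have "card (p ` D) \<le> card \<C>"
    using C(1) by (meson card_image_le card_mono le_trans)
  moreover have "X \<subseteq> (\<Union>x\<in>p ` D. cball x \<delta>)"
  proof
    fix y assume "y \<in> X"
    then obtain A where A: "A \<in> \<C>" "y \<in> A" using C(3) by blast
    then have "A \<in> D" using \<open>y \<in> X\<close> by (auto simp: D_def)
    moreover have "dist (p A) y \<le> \<delta>"
      using p[OF \<open>A \<in> D\<close>] A C(2)[OF A(1)] diameter_bounded_bound[of A "p A" y] by auto
    ultimately show "y \<in> (\<Union>x\<in>p ` D. cball x \<delta>)" by auto
  qed
  ultimately show ?thesis
    using fin p card by (intro exI[of _ "p ` D"]) (auto simp: hitting_set_def)
qed

definition mean_payoff :: "('a \<Rightarrow> real) measure \<Rightarrow> 'a \<Rightarrow> real" where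
  "mean_payoff P x = (\<integral>f. f x \<partial>P)"

definition measure_support :: "'b::topological_space measure \<Rightarrow> 'b set" where
  "measure_support P = {z \<in> space P. \<forall>U. open U \<and> z \<in> U \<longrightarrow> measure P (U \<inter> space P) > 0}"

(* The metric space is the whole type; [0,1]^X carries the topology of the function type, i.e. the
   product topology, and its full Borel sigma-algebra. *)
definition experts_instance :: "('a::metric_space \<Rightarrow> real) measure \<Rightarrow> bool" where
  "experts_instance P \<longleftrightarrow>
     prob_space P \<and> sets P = sets (restrict_space borel (UNIV \<rightarrow> {0..1})) \<and>
     1-lipschitz_on UNIV (mean_payoff P)"

definition uniformly_lipschitz :: "('a::metric_space \<Rightarrow> real) measure \<Rightarrow> bool" where
  "uniformly_lipschitz P \<longleftrightarrow> (\<forall>f \<in> measure_support P. 1-lipschitz_on UNIV f)"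

(* Rounds are numbered from 1. *)
definition iid_payoffs ::
  "('a \<Rightarrow> real) measure \<Rightarrow> 'w measure \<Rightarrow> (nat \<Rightarrow> 'w \<Rightarrow> 'a \<Rightarrow> real) \<Rightarrow> bool" where
  "iid_payoffs P M f \<longleftrightarrow>
     prob_space M \<and> prob_space.indep_vars M (\<lambda>_. P) f {1..} \<and> (\<forall>s\<ge>1. distr M P (f s) = P)"

definition regret ::
  "('a \<Rightarrow> real) measure \<Rightarrow> 'w measure \<Rightarrow> (nat \<Rightarrow> 'w \<Rightarrow> 'a) \<Rightarrow> nat \<Rightarrow> real" where
  "regret P M x t =
     real t * (SUP y. mean_payoff P y) - (\<integral>\<omega>. (\<Sum>s = 1..t. mean_payoff P (x s \<omega>)) \<partial>M)"

(* Phases 1, ..., i - 1 take 2^i - 2 rounds together. *)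
definition phase :: "nat \<Rightarrow> nat set" where
  "phase i = {2 ^ i - 1 ..< 2 ^ (i + 1) - 1}"

(* x is a sequence of plays that the algorithm can produce on the payoff functions f: the hitting
   sets S i, the plays in phase 1 and the way ties are broken (possibly at random) are free. *)
definition naive_exp ::
  "real \<Rightarrow> 'w measure \<Rightarrow> (nat \<Rightarrow> 'w \<Rightarrow> 'a::metric_space \<Rightarrow> real) \<Rightarrow> (nat \<Rightarrow> 'w \<Rightarrow> 'a) \<Rightarrow> bool" where
  "naive_exp a M f x \<longleftrightarrow>
     (\<forall>s\<ge>1. x s \<in> borel_measurable M) \<and>
     (\<exists>S xstar.
        (\<forall>i\<ge>1. let \<delta> = (2 ^ i) powr (- 1 / (a + 2)) in
           finite (S i) \<and> hitting_set UNIV \<delta> (S i) \<and>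
           enat (card (S i)) \<le> covering_number (UNIV :: 'a set) \<delta>) \<and>
        (\<forall>i\<ge>1. \<forall>\<omega>\<in>space M.
           is_arg_max (\<lambda>y. (\<Sum>s\<in>phase i. f s \<omega> y) / 2 ^ i) (\<lambda>y. y \<in> S i) (xstar i \<omega>) \<and>
           (\<forall>s\<in>phase (i + 1). x s \<omega> = xstar i \<omega>)))"

end

theory Submission
  imports Defs
begin

text \<open>
  In a phase of \<open>T\<close> rounds, playing the empirical maximizer over a \<open>\<delta>\<close>-hitting set costs at most
  \<open>\<delta>\<close> plus twice the maximal deviation of the sample averages from their means. A union bound over
  the hitting set is too weak for the exponent \<open>1 - 1 / b\<close>. Since the payoff functions are Lipschitz,
  the deviations at two points differ by a subgaussian variable of scale \<open>dist y z / sqrt T\<close>, so one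
  can chain through \<open>2 powr (- j)\<close>-nets. As the nets have at most \<open>exp (K * 2 powr (j * \<beta>))\<close> points
  for some \<open>\<beta> < b\<close>, the expected maximal deviation is of order
  \<open>\<delta> + (\<Sum>j. 2 powr (j * (\<beta> / 2 - 1))) / sqrt T\<close>, summed up to the scale \<open>2 powr (- j) \<approx> \<delta>\<close>. For
  \<open>\<delta> = T powr (- 1 / b)\<close> both terms are of order \<open>\<delta>\<close>.
\<close>

section \<open>Supports of Borel measures and compactness of the cube\<close>

text \<open>A point outside the support has an open null neighbourhood, and compactness reduces the
  cover of \<open>K\<close> by such neighbourhoods to a finite one, whose measures add up to
  0.\<close>

lemma measure_0_if_compact_disjoint_support:
  fixes P :: "'b::topological_space measure"
  assumes "finite_measure P" "sets P = sets (restrict_space borel A)"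
    and "compact K" "K \<subseteq> space P" "K \<inter> measure_support P = {}"
  shows "measure P K = 0"
proof -
  interpret finite_measure P by fact
  have sp: "space P = A"
    using sets_eq_imp_space_eq[OF assms(2)] by (simp add: space_restrict_space)
  have op: "U \<inter> space P \<in> sets P" if "open U" for U
    using that unfolding assms(2) sp by (auto simp: sets_restrict_space)
  define \<U> where "\<U> = {U. open U \<and> measure P (U \<inter> space P) = 0}"
  have "\<exists>U\<in>\<U>. z \<in> U" if "z \<in> K" for z
    using that assms(4,5) unfolding measure_support_def \<U>_def
    by (smt (verit) disjoint_iff measure_nonneg mem_Collect_eq subset_eq)
  then have cover: "K \<subseteq> \<Union>\<U>" by blast
  have "\<And>U. U \<in> \<U> \<Longrightarrow> open U" by (auto simp: \<U>_def)
  from compactE[OF assms(3) cover this] obtain D where D: "D \<subseteq> \<U>" "finite D" "K \<subseteq> \<Union>D"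
    by blast
  have "measure P K \<le> measure P (\<Union>U\<in>D. U \<inter> space P)"
  proof (rule finite_measure_mono)
    show "K \<subseteq> (\<Union>U\<in>D. U \<inter> space P)"
      using D(3) assms(4) by blast
    show "(\<Union>U\<in>D. U \<inter> space P) \<in> sets P"
      using D(1,2) op by (intro sets.finite_UN) (auto simp: \<U>_def)
  qed
  also have "\<dots> \<le> (\<Sum>U\<in>D. measure P (U \<inter> space P))"
    using D(1,2) op by (intro finite_measure_subadditive_finite) (auto simp: \<U>_def)
  also have "\<dots> = 0"
    using D(1) by (auto simp: \<U>_def intro!: sum.neutral)
  finally show ?thesis
    using measure_nonneg[of P K] by linarith
qed

text \<open>Tychonoff's theorem, transferred from \<open>product_topology\<close> to the topology of
  the function type.\<close>

lemma compact_unit_cube: "compact (UNIV \<rightarrow> {0..1} :: ('a \<Rightarrow> real) set)"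
proof -
  have "compactin (product_topology (\<lambda>i::'a. euclidean :: real topology) UNIV)
          (PiE UNIV (\<lambda>_. {0..1}))"
    by (subst compactin_PiE) auto
  then show ?thesis
    by (simp add: euclidean_product_topology PiE_UNIV_domain)
qed

section \<open>Maxima of finitely many subgaussian variables\<close>

text \<open>The two expected exponentials are turned into an integrable majorant of all \<open>\<bar>Y k\<bar>\<close> at once by
  the tangent inequality \<open>l z \<le> L - 1 + exp (l z - L)\<close>, optimised at \<open>L = 2 A\<close>.\<close>

lemma (in prob_space) subgaussian_majorant:
  fixes Y :: "'k \<Rightarrow> 'a \<Rightarrow> real"
  assumes fin: "finite K" and A: "A > 0" and \<sigma>: "\<sigma> > 0" and card: "2 * real (card K) \<le> exp A"
    and meas [measurable]: "\<And>k. k \<in> K \<Longrightarrow> Y k \<in> borel_measurable M"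
    and up: "\<And>k l. k \<in> K \<Longrightarrow> l > 0 \<Longrightarrow>
        (\<integral>\<^sup>+\<omega>. ennreal (exp (l * Y k \<omega>)) \<partial>M) \<le> ennreal (exp (l\<^sup>2 * \<sigma>\<^sup>2 / 2))"
    and lo: "\<And>k l. k \<in> K \<Longrightarrow> l > 0 \<Longrightarrow>
        (\<integral>\<^sup>+\<omega>. ennreal (exp (l * - Y k \<omega>)) \<partial>M) \<le> ennreal (exp (l\<^sup>2 * \<sigma>\<^sup>2 / 2))"
  shows "\<exists>G. integrable M G \<and> (\<forall>\<omega>. \<forall>k\<in>K. \<bar>Y k \<omega>\<bar> \<le> G \<omega>) \<and> expectation G \<le> \<sigma> * sqrt (2 * A)"
proof -
  \<comment> \<open>With this \<open>l\<close> every exponential moment is at most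
    \<open>exp A\<close>. Since \<open>2 * card K\<close> is at most \<open>exp A\<close> too, their
    sum \<open>E\<close> has expectation at most \<open>exp (2 * A)\<close>, which the factor
    \<open>exp (- (2 * A))\<close> in \<open>G\<close> cancels.\<close>
  define l where "l = sqrt (2 * A) / \<sigma>"
  have l: "l > 0" using A \<sigma> by (simp add: l_def)
  have lA: "l\<^sup>2 * \<sigma>\<^sup>2 / 2 = A" using A \<sigma> by (simp add: l_def power_divide)
  have exp_bound: "integrable M (\<lambda>\<omega>. exp (l * Z \<omega>)) \<and> expectation (\<lambda>\<omega>. exp (l * Z \<omega>)) \<le> exp A"
    if [measurable]: "Z \<in> borel_measurable M"
      and Z: "(\<integral>\<^sup>+\<omega>. ennreal (exp (l * Z \<omega>)) \<partial>M) \<le> ennreal (exp A)" for Z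
  proof
    \<comment> \<open>The moment bounds are stated with nonnegative integrals, so finiteness gives
      integrability.\<close>
    show int: "integrable M (\<lambda>\<omega>. exp (l * Z \<omega>))"
      using Z by (intro integrableI_nonneg) (auto simp: less_top[symmetric] top_unique)
    show "expectation (\<lambda>\<omega>. exp (l * Z \<omega>)) \<le> exp A"
      using Z by (subst (asm) nn_integral_eq_integral[OF int]) (auto simp: ennreal_le_iff)
  qed
  have up': "integrable M (\<lambda>\<omega>. exp (l * Y k \<omega>)) \<and> expectation (\<lambda>\<omega>. exp (l * Y k \<omega>)) \<le> exp A"
    and lo': "integrable M (\<lambda>\<omega>. exp (l * - Y k \<omega>)) \<and> expectation (\<lambda>\<omega>. exp (l * - Y k \<omega>)) \<le> exp A"
    if "k \<in> K" for k
    using exp_bound[of "Y k"] exp_bound[of "\<lambda>\<omega>. - Y k \<omega>"] meas[OF that] up[OF that l] lo[OF that l]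
    by (auto simp: lA)
  define E where "E \<omega> = (\<Sum>k\<in>K. exp (l * Y k \<omega>) + exp (l * - Y k \<omega>))" for \<omega>
  define G where "G \<omega> = (2 * A - 1 + exp (- (2 * A)) * E \<omega>) / l" for \<omega>
  have intE: "integrable M E"
    unfolding E_def using up' lo' by (intro Bochner_Integration.integrable_sum) auto
  have "expectation E = (\<Sum>k\<in>K. expectation (\<lambda>\<omega>. exp (l * Y k \<omega>)) + expectation (\<lambda>\<omega>. exp (l * - Y k \<omega>)))"
    unfolding E_def using up' lo' by (subst Bochner_Integration.integral_sum) (auto intro!: sum.cong)
  also have "\<dots> \<le> (\<Sum>k\<in>K. exp A + exp A)"
    using up' lo' by (intro sum_mono add_mono) auto
  also have "\<dots> = 2 * real (card K) * exp A" by simp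
  also have "\<dots> \<le> exp A * exp A" using card by (intro mult_right_mono) auto
  finally have EE: "expectation E \<le> exp (2 * A)" by (simp flip: exp_add)
  have intG: "integrable M G" unfolding G_def using intE by auto
  have "expectation G = (2 * A - 1 + exp (- (2 * A)) * expectation E) / l"
    unfolding G_def using intE by (simp add: prob_space)
  also have "\<dots> \<le> (2 * A - 1 + exp (- (2 * A)) * exp (2 * A)) / l"
    using EE l by (intro divide_right_mono add_left_mono mult_left_mono) auto
  also have "\<dots> = 2 * A / l" by (simp flip: exp_add)
  also have "\<dots> = \<sigma> * (2 * A / sqrt (2 * A))" using \<sigma> by (simp add: l_def)
  also have "\<dots> = \<sigma> * sqrt (2 * A)" using A by (subst real_div_sqrt) auto
  finally have "expectation G \<le> \<sigma> * sqrt (2 * A)" .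
  moreover have "\<bar>Y k \<omega>\<bar> \<le> G \<omega>" if k: "k \<in> K" for k \<omega>
  proof -
    have t: "l * z \<le> 2 * A - 1 + exp (- (2 * A)) * E \<omega>" if "exp (l * z) \<le> E \<omega>" for z
    proof -
      have "l * z \<le> 2 * A - 1 + exp (l * z - 2 * A)"
        using exp_ge_add_one_self[of "l * z - 2 * A"] by linarith
      also have "exp (l * z - 2 * A) = exp (- (2 * A)) * exp (l * z)" by (simp flip: exp_add)
      also have "\<dots> \<le> exp (- (2 * A)) * E \<omega>" using that by (intro mult_left_mono) auto
      finally show ?thesis by simp
    qed
    have "exp (l * Y k \<omega>) + exp (l * - Y k \<omega>) \<le> E \<omega>"
      unfolding E_def using fin k by (intro member_le_sum) auto
    then have "exp (l * Y k \<omega>) \<le> E \<omega>" "exp (l * - Y k \<omega>) \<le> E \<omega>"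
      using exp_gt_zero[of "l * Y k \<omega>"] exp_gt_zero[of "l * - Y k \<omega>"] by linarith+
    from t[OF this(1)] t[OF this(2)] show ?thesis
      using l by (simp add: G_def field_simps abs_le_iff)
  qed
  ultimately show ?thesis using intG by blast
qed

section \<open>Covering numbers and the log-covering dimension\<close>

lemma hitting_setD:
  assumes "hitting_set X \<delta> S" "y \<in> X"
  obtains z where "z \<in> S" "dist z y \<le> \<delta>"
proof -
  have "y \<in> (\<Union>z\<in>S. cball z \<delta>)" using assms unfolding hitting_set_def by (blast dest: subsetD)
  then show ?thesis using that by auto
qed

lemma covering_number_antimono:
  assumes "r \<le> s" shows "covering_number X s \<le> covering_number X r"
  unfolding covering_number_def using assms by (intro INF_superset_mono) force+

text \<open>The limsup controls only small radii; the constant \<open>K\<close> extends the bound to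
  all radii up to 1. The factor 2 serves \<open>subgaussian_majorant\<close>, which counts each
  variable with both signs.\<close>

lemma LCD_less_imp_covering_number_le:
  assumes "LCD X < ereal b" "b > 0"
  obtains \<beta> K where "\<beta> < b" "K > 0"
    "\<And>r. 0 < r \<Longrightarrow> r \<le> 1 \<Longrightarrow> \<exists>n. covering_number X r = enat n \<and> 2 * real n \<le> exp (K * r powr - \<beta>)"
proof -
  \<comment> \<open>Positivity of \<open>\<beta>\<close> gives
    \<open>1 \<le> r powr - \<beta>\<close> for \<open>r \<le> 1\<close>; the gap below
    \<open>b\<close> later makes a geometric series converge.\<close>
  obtain \<beta> where \<beta>: "max 0 (LCD X) < ereal \<beta>" "ereal \<beta> < ereal b"
    using ereal_dense3[of "max 0 (LCD X)" "ereal b"] ereal_dense2[of "max 0 (LCD X)" "ereal b"] assms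
    by (auto simp: zero_ereal_def)
  have "\<forall>\<^sub>F r in at_right 0. loglog (covering_number X r) / ereal (ln (1 / r)) < ereal \<beta>"
    using \<beta>(1) unfolding LCD_def by (intro Limsup_lessD) auto
  then obtain r0 where r0: "r0 > 0"
    "\<And>r. 0 < r \<Longrightarrow> r < r0 \<Longrightarrow> loglog (covering_number X r) / ereal (ln (1 / r)) < ereal \<beta>"
    by (auto simp: eventually_at_right_field)
  have small: "\<exists>n. covering_number X r = enat n \<and> real n \<le> exp (r powr - \<beta>)"
    if r: "0 < r" "r < min r0 1" for r
  proof -
    have ln: "ln (1 / r) > 0" using r by (intro ln_gt_zero) auto
    have "loglog (covering_number X r) / ereal (ln (1 / r)) < ereal \<beta>" using r r0(2) by auto
    then have lt: "loglog (covering_number X r) < ereal (\<beta> * ln (1 / r))"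
      using ln by (subst (asm) ereal_divide_less_iff) (auto simp: mult.commute)
    then obtain n where n: "covering_number X r = enat n"
      by (cases "covering_number X r") (auto simp: loglog_def)
    have "real n \<le> exp (r powr - \<beta>)"
    \<comment> \<open>For \<open>n \<le> 1\<close> the value of \<open>loglog\<close> is
      \<open>-\<infinity>\<close> and carries no information, but the bound is trivial.\<close>
    proof (cases "n \<le> 1")
      case True
      then have "real n \<le> 1" by simp
      also have "1 \<le> exp (r powr - \<beta>)" by simp
      finally show ?thesis .
    next
      case False
      then have "ln (ln (real n)) < \<beta> * ln (1 / r)" using lt n by (simp add: loglog_def)
      also have "\<beta> * ln (1 / r) = ln (r powr - \<beta>)" using r by (simp add: ln_powr ln_div)
      finally have "ln (real n) < r powr - \<beta>"
        using False r by (subst (asm) ln_less_cancel_iff) auto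
      then show ?thesis using False by (subst ln_le_cancel_iff[symmetric]) auto
    qed
    with n show ?thesis by blast
  qed
  define r1 where "r1 = min r0 1 / 2"
  have r1: "0 < r1" "r1 < min r0 1" "r1 < 1" using r0(1) by (auto simp: r1_def)
  \<comment> \<open>The first summand covers radii from \<open>r1\<close> upwards, where the
    covering number is at most the one at \<open>r1\<close>. The 1 absorbs the factor 2, as
    \<open>2 \<le> exp 1 \<le> exp (r powr - \<beta>)\<close>.\<close>
  define K where "K = r1 powr - \<beta> + 1"
  have pos: "\<beta> > 0" using \<beta>(1) by simp
  have r1K: "1 \<le> r1 powr - \<beta>" using r1 pos powr_mono2'[of "-\<beta>" r1 1] by auto
  have main: "\<exists>n. covering_number X r = enat n \<and> 2 * real n \<le> exp (K * r powr - \<beta>)"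
    if r: "0 < r" "r \<le> 1" for r
  proof -
    have r_ge: "1 \<le> r powr - \<beta>" using r pos powr_mono2'[of "-\<beta>" r 1] by auto
    obtain n where n: "covering_number X r = enat n" "real n \<le> exp (r1 powr - \<beta> * r powr - \<beta>)"
    proof (cases "r < r1")
      case True
      then obtain n where n: "covering_number X r = enat n" "real n \<le> exp (r powr - \<beta>)"
        using small[of r] r r1 by auto
      have "1 * r powr - \<beta> \<le> r1 powr - \<beta> * r powr - \<beta>" using r1K by (intro mult_right_mono) auto
      then have "exp (r powr - \<beta>) \<le> exp (r1 powr - \<beta> * r powr - \<beta>)" by simp
      with n have "real n \<le> exp (r1 powr - \<beta> * r powr - \<beta>)" by linarith
      with n that show ?thesis by blast
    next
      case False
      obtain m where m: "covering_number X r1 = enat m" "real m \<le> exp (r1 powr - \<beta>)"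
        using small[of r1] r1 by auto
      have le: "covering_number X r \<le> enat m"
        using covering_number_antimono[of r1 r X] False m by simp
      then obtain n where n: "covering_number X r = enat n" "n \<le> m"
        by (cases "covering_number X r") auto
      have "r1 powr - \<beta> * 1 \<le> r1 powr - \<beta> * r powr - \<beta>" using r_ge by (intro mult_left_mono) auto
      then have "exp (r1 powr - \<beta>) \<le> exp (r1 powr - \<beta> * r powr - \<beta>)" by simp
      with m n have "real n \<le> exp (r1 powr - \<beta> * r powr - \<beta>)"
        by (meson of_nat_le_iff order_trans)
      with n that show ?thesis by blast
    qed
    have "(2::real) \<le> exp 1" using exp_ge_add_one_self[of 1] by simp
    also have "\<dots> \<le> exp (r powr - \<beta>)" using r_ge by simp
    finally have "2 * real n \<le> exp (r powr - \<beta>) * exp (r1 powr - \<beta> * r powr - \<beta>)"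
      using n(2) by (intro mult_mono) auto
    also have "\<dots> = exp (K * r powr - \<beta>)" by (simp add: K_def algebra_simps flip: exp_add)
    finally show ?thesis using n by blast
  qed
  have "\<beta> < b" using \<beta>(2) by simp
  moreover have "K > 0" using r1K by (simp add: K_def)
  ultimately show ?thesis using that main by blast
qed

section \<open>Two deterministic sums\<close>

text \<open>The increment of the right-hand side dominates the new summand: with
  \<open>u = 1 / Suc t\<close>, the condition \<open>p \<le> 1 / 2\<close> gives
  \<open>(1 - u) powr (1 - p) \<le> sqrt (1 - u) \<le> 1 - u / 2\<close>.\<close>

lemma sum_powr_minus_le:
  fixes p :: real
  assumes "0 \<le> p" "p \<le> 1 / 2"
  shows "(\<Sum>s = 1..t. real s powr - p) \<le> 2 * real t powr (1 - p)"
proof (induction t)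
  case (Suc t)
  define u where "u = 1 / real (Suc t)"
  have u: "0 < u" "u \<le> 1" by (auto simp: u_def)
  have "real (Suc t) * u = 1" by (simp add: u_def)
  then have "real t = real (Suc t) * (1 - u)" unfolding right_diff_distrib by simp
  then have "real t powr (1 - p) = (real (Suc t) * (1 - u)) powr (1 - p)" by (rule arg_cong)
  also have "\<dots> = real (Suc t) powr (1 - p) * (1 - u) powr (1 - p)"
    by (rule powr_mult)
  also have "(1 - u) powr (1 - p) \<le> (1 - u) powr (1 / 2)"
    using assms u by (intro powr_mono') auto
  also have "(1 - u) powr (1 / 2) = sqrt (1 - u)" using u by (simp add: powr_half_sqrt)
  also have "\<dots> \<le> 1 - u / 2"
    using u by (intro real_le_lsqrt) (auto simp: power2_eq_square field_simps)
  finally have "2 * real t powr (1 - p) \<le> 2 * real (Suc t) powr (1 - p) - real (Suc t) powr (1 - p) * u"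
    by (simp add: mult_left_mono algebra_simps)
  also have "real (Suc t) powr (1 - p) * u = real (Suc t) powr - p"
    using powr_diff[of "real (Suc t)" "1-p" 1] by (simp add: u_def)
  finally show ?case using Suc by simp
qed simp

text \<open>The exponent \<open>\<beta> / 2 - 1\<close> may have either sign, so
  \<open>\<beta>\<close> is raised to \<open>b\<close> at the price of a factor
  \<open>q ^ j\<close>. As \<open>b \<ge> 2\<close>, the powers with \<open>b\<close> are largest at
  the last index, and the factors \<open>q ^ j\<close> form a convergent geometric series.\<close>

lemma dudley_sum_le:
  fixes b \<beta> :: real
  assumes "\<beta> < b" "b \<ge> 2"
  shows "(\<Sum>j = 1..nat \<lceil>real i / b\<rceil>. 2 powr (real j * (\<beta> / 2 - 1))) * 2 powr (- real i / 2)
       \<le> 2 powr (b / 2 - 1) / (1 - 2 powr (- (b - \<beta>) / 2)) * 2 powr (- real i / b)"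
proof -
  define J where "J = nat \<lceil>real i / b\<rceil>"
  define q :: real where "q = 2 powr (- (b - \<beta>) / 2)"
  have q: "0 < q" "q < 1" using assms by (auto simp: q_def powr_less_one)
  have J: "real J \<le> real i / b + 1" using assms unfolding J_def by simp
  have "(\<Sum>j = 1..J. 2 powr (real j * (\<beta> / 2 - 1))) \<le> (\<Sum>j = 1..J. 2 powr (real J * (b / 2 - 1)) * q ^ j)"
  proof (rule sum_mono)
    fix j assume j: "j \<in> {1..J}"
    have "(2::real) powr (real j * (\<beta> / 2 - 1)) = 2 powr (real j * (b / 2 - 1)) * q ^ j"
      using assms by (simp add: q_def powr_powr algebra_simps add_divide_distrib diff_divide_distrib
          flip: powr_realpow powr_add)
    also have "\<dots> \<le> 2 powr (real J * (b / 2 - 1)) * q ^ j"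
      using j assms q by (intro mult_right_mono powr_mono) auto
    finally show "(2::real) powr (real j * (\<beta> / 2 - 1)) \<le> 2 powr (real J * (b / 2 - 1)) * q ^ j" .
  qed
  also have "\<dots> = 2 powr (real J * (b / 2 - 1)) * (\<Sum>j = 1..J. q ^ j)" by (simp add: sum_distrib_left)
  also have "\<dots> \<le> 2 powr ((real i / b + 1) * (b / 2 - 1)) * (1 / (1 - q))"
  proof (intro mult_mono powr_mono mult_right_mono J)
    have "(\<Sum>j = 1..J. q ^ j) \<le> (\<Sum>j. q ^ j)"
      using q by (intro sum_le_suminf summable_geometric) auto
    then show "(\<Sum>j = 1..J. q ^ j) \<le> 1 / (1 - q)" using q by (simp add: suminf_geometric)
  qed (use assms q in \<open>auto intro!: sum_nonneg\<close>)
  finally have "(\<Sum>j = 1..J. 2 powr (real j * (\<beta> / 2 - 1))) * 2 powr (- real i / 2)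
      \<le> 2 powr ((real i / b + 1) * (b / 2 - 1)) * (1 / (1 - q)) * 2 powr (- real i / 2)"
    by (intro mult_right_mono) auto
  also have "\<dots> = 2 powr ((real i / b + 1) * (b / 2 - 1) + (- real i / 2)) * (1 / (1 - q))"
    by (simp only: powr_add mult_ac)
  \<comment> \<open>Rounding \<open>real i / b\<close> up costs only the constant
    \<open>2 powr (b / 2 - 1)\<close>; the terms \<open>real i / 2\<close> cancel.\<close>
  also have "(real i / b + 1) * (b / 2 - 1) + (- real i / 2) = (b / 2 - 1) + (- real i / b)"
    using assms by (simp add: field_simps)
  also have "2 powr ((b / 2 - 1) + (- real i / b)) * (1 / (1 - q))
      = 2 powr (b / 2 - 1) / (1 - q) * 2 powr (- real i / b)"
    by (simp only: powr_add) simp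
  finally show ?thesis unfolding J_def q_def .
qed

section \<open>The random payoff functions\<close>

locale lipschitz_experts =
  fixes P :: "('a::metric_space \<Rightarrow> real) measure" and M :: "'w measure"
    and f :: "nat \<Rightarrow> 'w \<Rightarrow> 'a \<Rightarrow> real"
  assumes inst: "experts_instance P" and lipschitz: "uniformly_lipschitz P"
    and iid: "iid_payoffs P M f"
begin

sublocale P: prob_space P
  using inst by (simp add: experts_instance_def)

sublocale prob_space M
  using iid by (simp add: iid_payoffs_def)

lemma sets_P: "sets P = sets (restrict_space borel (UNIV \<rightarrow> {0..1}))"
  using inst by (simp add: experts_instance_def)

lemma space_P: "space P = UNIV \<rightarrow> {0..1}"
  using sets_eq_imp_space_eq[OF sets_P] by (simp add: space_restrict_space)

lemma payoff_measurable [measurable]: "(\<lambda>g. g y) \<in> borel_measurable P"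
proof -
  have "(\<lambda>g :: 'a \<Rightarrow> real. g y) \<in> borel_measurable borel"
    by (intro borel_measurable_continuous_onI continuous_on_product_coordinates)
  then have "(\<lambda>g :: 'a \<Rightarrow> real. g y) \<in> borel_measurable (restrict_space borel (UNIV \<rightarrow> {0..1}))"
    by (rule measurable_restrict_space1)
  then show ?thesis
    using measurable_cong_sets[OF sets_P refl] by blast
qed

lemma payoff_bounds: "g \<in> space P \<Longrightarrow> 0 \<le> g y \<and> g y \<le> 1"
  by (auto simp: space_P Pi_iff)

lemma integrable_payoff: "integrable P (\<lambda>g. g y)"
  using payoff_bounds by (intro P.integrable_const_bound[of _ 1]) (auto intro!: AE_I2)

lemma mean_payoff_bounds: "0 \<le> mean_payoff P y" "mean_payoff P y \<le> 1"
  unfolding mean_payoff_def using payoff_bounds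
  by (auto intro!: integral_nonneg_AE P.integral_le_const integrable_payoff AE_I2)

lemma mean_payoff_lipschitz: "\<bar>mean_payoff P y - mean_payoff P z\<bar> \<le> dist y z"
  using inst lipschitz_onD[of 1 UNIV "mean_payoff P" y z]
  by (auto simp: experts_instance_def dist_real_def)

lemma mean_payoff_measurable [measurable]: "mean_payoff P \<in> borel_measurable borel"
  using inst unfolding experts_instance_def
  by (intro borel_measurable_continuous_onI) (auto dest: lipschitz_on_continuous_on)

lemma draw_measurable: "s \<ge> 1 \<Longrightarrow> f s \<in> measurable M P"
  using iid by (auto simp: iid_payoffs_def indep_vars_def)

lemma draw_payoff_measurable [measurable]: "s \<ge> 1 \<Longrightarrow> (\<lambda>\<omega>. f s \<omega> y) \<in> borel_measurable M"
  using measurable_compose[OF draw_measurable payoff_measurable] .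

lemma distr_draw: "s \<ge> 1 \<Longrightarrow> distr M P (f s) = P"
  using iid by (simp add: iid_payoffs_def)

lemma expectation_draw:
  assumes "s \<ge> 1" shows "expectation (\<lambda>\<omega>. f s \<omega> y) = mean_payoff P y"
  using integral_distr[OF draw_measurable[OF assms] payoff_measurable[of y]]
  by (simp add: mean_payoff_def distr_draw[OF assms])

lemma integrable_draw:
  assumes "s \<ge> 1" shows "integrable M (\<lambda>\<omega>. f s \<omega> y)"
  using integrable_distr[OF draw_measurable[OF assms], of "\<lambda>g. g y"] integrable_payoff[of y]
  by (simp add: distr_draw[OF assms])

text \<open>For uncountable \<open>'a\<close> the support of a Borel measure on the cube may be a null set, so
  \<open>P\<close> need not be concentrated on Lipschitz functions. Compactness of the cube still
  gives the Lipschitz bound almost surely at any two given points.\<close>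

lemma AE_payoff_lipschitz_le: "AE g in P. g y - g z \<le> dist y z"
proof -
  have "AE g in P. \<not> (g y - g z \<ge> dist y z + 1 / real (Suc n))" for n
  proof -
    \<comment> \<open>The slack \<open>1 / Suc n\<close> makes the violation of the Lipschitz bound
      a closed condition, so that \<open>K\<close> is compact. These sets exhaust the event where
      the bound fails.\<close>
    define K where "K = {g \<in> space P. g y - g z \<ge> dist y z + 1 / real (Suc n)}"
    have "closed {g :: 'a \<Rightarrow> real. dist y z + 1 / real (Suc n) \<le> g y - g z}"
      by (intro closed_Collect_le continuous_intros continuous_on_product_coordinates)
    then have "compact ((UNIV \<rightarrow> {0..1}) \<inter> {g :: 'a \<Rightarrow> real. dist y z + 1 / real (Suc n) \<le> g y - g z})"
      by (rule compact_Int_closed[OF compact_unit_cube])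
    also have "(UNIV \<rightarrow> {0..1}) \<inter> {g :: 'a \<Rightarrow> real. dist y z + 1 / real (Suc n) \<le> g y - g z} = K"
      by (auto simp: K_def space_P)
    finally have "compact K" .
    moreover have "K \<inter> measure_support P = {}"
    proof -
      have "g y - g z \<le> dist y z" if "g \<in> measure_support P" for g
        using lipschitz that lipschitz_onD[of 1 UNIV g y z]
        by (auto simp: uniformly_lipschitz_def dist_real_def)
      moreover have "0 < 1 / real (Suc n)" by simp
      ultimately show ?thesis unfolding K_def by (smt (verit) disjoint_iff mem_Collect_eq)
    qed
    ultimately have "measure P K = 0"
      by (intro measure_0_if_compact_disjoint_support[OF P.finite_measure_axioms sets_P])
         (auto simp: K_def)
    then have "emeasure P K = 0" by (simp add: P.emeasure_eq_measure)
    then show ?thesis unfolding K_def by (subst AE_iff_measurable[OF _ refl]) auto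
  qed
  then have "AE g in P. \<forall>n. \<not> (g y - g z \<ge> dist y z + 1 / real (Suc n))"
    by (subst AE_all_countable) blast
  then show ?thesis
  proof eventually_elim
    case (elim g)
    show ?case
    proof (rule ccontr)
      assume "\<not> g y - g z \<le> dist y z"
      then obtain n where "1 / real (Suc n) < g y - g z - dist y z"
        using nat_approx_posE[of "g y - g z - dist y z"] by auto
      with elim show False by (smt (verit))
    qed
  qed
qed

lemma AE_draw_lipschitz:
  assumes "s \<ge> 1" shows "AE \<omega> in M. \<bar>f s \<omega> y - f s \<omega> z\<bar> \<le> dist y z"
proof -
  have "AE g in P. \<bar>g y - g z\<bar> \<le> dist y z"
    using AE_payoff_lipschitz_le[of y z] AE_payoff_lipschitz_le[of z y]
    by eventually_elim (simp add: abs_le_iff dist_commute)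
  then show ?thesis
    by (rule AE_distrD[OF draw_measurable[OF assms], unfolded distr_draw[OF assms]])
qed

section \<open>Deviations of sample averages and chaining\<close>

definition dev :: "nat set \<Rightarrow> 'a \<Rightarrow> 'w \<Rightarrow> real" where
  "dev I y \<omega> = (\<Sum>s\<in>I. f s \<omega> y) / real (card I) - mean_payoff P y"

context
  fixes I :: "nat set"
  assumes I: "finite I" "I \<noteq> {}" "I \<subseteq> {1..}"
begin

lemma dev_measurable [measurable]: "dev I y \<in> borel_measurable M"
proof -
  have [measurable]: "\<And>s. s \<in> I \<Longrightarrow> (\<lambda>\<omega>. f s \<omega> y) \<in> borel_measurable M"
    using I(3) by (intro draw_payoff_measurable) auto
  show ?thesis unfolding dev_def by measurable
qed

lemma card_pos: "real (card I) > 0"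
  using I by (simp add: card_gt_0_iff)

text \<open>Independence factorises the exponential moment, and Hoeffding's lemma applies to each
  factor, since \<open>f s \<omega> y - f s \<omega> z\<close> lies almost surely in an interval of
  length \<open>2 * d\<close>. Here the Lipschitz bound replaces the range of the payoffs by the
  distance.\<close>

lemma dev_diff_subgaussian:
  assumes "dist y z \<le> d" "l > 0"
  shows "(\<integral>\<^sup>+\<omega>. ennreal (exp (l * (dev I y \<omega> - dev I z \<omega>))) \<partial>M)
     \<le> ennreal (exp (l\<^sup>2 * (d / sqrt (real (card I)))\<^sup>2 / 2))"
proof -
  define T where "T = real (card I)"
  have T: "T > 0" using card_pos by (simp add: T_def)
  define X where "X s \<omega> = f s \<omega> y - f s \<omega> z" for s \<omega>
  have EX: "expectation (X s) = mean_payoff P y - mean_payoff P z" if "s \<in> I" for s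
    unfolding X_def using that I(3) integrable_draw[of s] expectation_draw[of s] by auto
  have "indep_vars (\<lambda>_. P) f I"
    using iid I(3) unfolding iid_payoffs_def by (blast intro: indep_vars_subset)
  then have indep: "indep_vars (\<lambda>_. borel) X I"
    unfolding X_def by (rule indep_vars_compose2) measurable
  have X_bound: "AE \<omega> in M. X s \<omega> \<in> {-d..d}" if "s \<in> I" for s
  proof -
    have "s \<ge> 1" using that I(3) by auto
    from AE_draw_lipschitz[OF this, of y z] show ?thesis
      by eventually_elim (use assms(1) in \<open>auto simp: X_def\<close>)
  qed
  have eq: "ennreal (exp (l * (dev I y \<omega> - dev I z \<omega>)))
      = (\<Prod>s\<in>I. ennreal (exp (l / T * (X s \<omega> - expectation (X s)))))" for \<omega>
  proof -
    have "dev I y \<omega> - dev I z \<omega> = (\<Sum>s\<in>I. X s \<omega>) / T - (mean_payoff P y - mean_payoff P z)"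
      by (simp add: dev_def X_def sum_subtractf T_def diff_divide_distrib)
    also have "\<dots> = (\<Sum>s\<in>I. X s \<omega> - expectation (X s)) / T"
      using T by (simp add: sum_subtractf EX diff_divide_distrib T_def)
    finally have "l * (dev I y \<omega> - dev I z \<omega>) = (\<Sum>s\<in>I. l / T * (X s \<omega> - expectation (X s)))"
      by (simp add: sum_distrib_left sum_divide_distrib)
    then show ?thesis using I(1) by (simp add: exp_sum prod_ennreal)
  qed
  have "(\<integral>\<^sup>+\<omega>. ennreal (exp (l * (dev I y \<omega> - dev I z \<omega>))) \<partial>M)
      = (\<Prod>s\<in>I. \<integral>\<^sup>+\<omega>. ennreal (exp (l / T * (X s \<omega> - expectation (X s)))) \<partial>M)"
    unfolding eq by (intro indep_vars_nn_integral I(1) indep_vars_compose2[OF indep]) auto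
  also have "\<dots> \<le> (\<Prod>s\<in>I. ennreal (exp ((l / T)\<^sup>2 * (d - - d)\<^sup>2 / 8)))"
  proof (intro prod_mono_ennreal)
    fix s assume s: "s \<in> I"
    have "s \<ge> 1" using s I(3) by auto
    interpret interval_bounded_random_variable M "X s" "-d" d
    proof unfold_locales
      show "X s \<in> borel_measurable M"
        unfolding X_def using \<open>s \<ge> 1\<close> by (intro borel_measurable_diff draw_payoff_measurable)
      show "AE \<omega> in M. X s \<omega> \<in> {-d..d}" by (rule X_bound[OF s])
    qed
    show "(\<integral>\<^sup>+\<omega>. ennreal (exp (l / T * (X s \<omega> - expectation (X s)))) \<partial>M)
        \<le> ennreal (exp ((l / T)\<^sup>2 * (d - - d)\<^sup>2 / 8))"
      using assms(2) T by (intro Hoeffdings_lemma_nn_integral divide_pos_pos)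
  qed
  also have "\<dots> = ennreal (exp (T * ((l / T)\<^sup>2 * (d - - d)\<^sup>2 / 8)))"
    by (simp add: ennreal_power T_def flip: exp_of_nat_mult)
  also have "T * ((l / T)\<^sup>2 * (d - - d)\<^sup>2 / 8) = l\<^sup>2 * (d / sqrt T)\<^sup>2 / 2"
    using T by (simp add: power_divide power2_eq_square field_simps)
  finally show ?thesis by (simp add: T_def)
qed

text \<open>Each point of \<open>H (Suc J)\<close> is linked to a point of \<open>H J\<close> at
  distance at most \<open>(1/2) ^ J\<close>, and the links are summed by induction. A link is
  determined by its finer end, so level \<open>j\<close> has at most \<open>card (H j)\<close> of
  them; \<open>2 * (1/2) ^ j\<close> is the radius of the coarser net. Subtracting
  \<open>dev I x0 \<omega>\<close> makes the base case zero. A pointwise majorant can later be used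
  at random points.\<close>

lemma chaining_majorant:
  fixes H :: "nat \<Rightarrow> 'a set" and A :: "nat \<Rightarrow> real"
  assumes H0: "H 0 = {x0}"
    and H: "\<And>j. finite (H j)" "\<And>j. hitting_set UNIV ((1/2) ^ j) (H j)"
    and A: "\<And>j. A j > 0" "\<And>j. 2 * real (card (H j)) \<le> exp (A j)"
  shows "\<exists>G. integrable M G \<and> (\<forall>\<omega>. \<forall>y\<in>H J. \<bar>dev I y \<omega> - dev I x0 \<omega>\<bar> \<le> G \<omega>) \<and>
     expectation G \<le> (\<Sum>j = 1..J. 2 * (1/2) ^ j / sqrt (real (card I)) * sqrt (2 * A j))"
proof (induction J)
  case 0
  show ?case by (intro exI[of _ "\<lambda>_. 0"]) (auto simp: H0)
next
  case (Suc J)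
  then obtain G where G: "integrable M G" "\<And>\<omega> y. y \<in> H J \<Longrightarrow> \<bar>dev I y \<omega> - dev I x0 \<omega>\<bar> \<le> G \<omega>"
    "expectation G \<le> (\<Sum>j = 1..J. 2 * (1/2) ^ j / sqrt (real (card I)) * sqrt (2 * A j))"
    by blast
  have "\<exists>z\<in>H J. dist z y \<le> (1/2) ^ J" for y
    using hitting_setD[OF H(2)[of J]] by (metis UNIV_I)
  then obtain \<pi> where \<pi>: "\<And>y. \<pi> y \<in> H J" "\<And>y. dist (\<pi> y) y \<le> (1/2) ^ J"
    by metis
  have "\<exists>G'. integrable M G' \<and> (\<forall>\<omega>. \<forall>y\<in>H (Suc J). \<bar>dev I y \<omega> - dev I (\<pi> y) \<omega>\<bar> \<le> G' \<omega>) \<and>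
     expectation G' \<le> (1/2) ^ J / sqrt (real (card I)) * sqrt (2 * A (Suc J))"
  proof (rule subgaussian_majorant)
    fix y and l :: real assume l: "l > 0"
    show "(\<integral>\<^sup>+\<omega>. ennreal (exp (l * (dev I y \<omega> - dev I (\<pi> y) \<omega>))) \<partial>M)
        \<le> ennreal (exp (l\<^sup>2 * ((1/2) ^ J / sqrt (real (card I)))\<^sup>2 / 2))"
      using \<pi>(2)[of y] l by (intro dev_diff_subgaussian) (auto simp: dist_commute)
    show "(\<integral>\<^sup>+\<omega>. ennreal (exp (l * - (dev I y \<omega> - dev I (\<pi> y) \<omega>))) \<partial>M)
        \<le> ennreal (exp (l\<^sup>2 * ((1/2) ^ J / sqrt (real (card I)))\<^sup>2 / 2))"
      \<comment> \<open>The opposite sign is the same bound with the two points exchanged.\<close>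
      using dev_diff_subgaussian[OF \<pi>(2)[of y] l] by simp
  qed (use H A card_pos in auto)
  then obtain G' where G': "integrable M G'"
    "\<And>\<omega> y. y \<in> H (Suc J) \<Longrightarrow> \<bar>dev I y \<omega> - dev I (\<pi> y) \<omega>\<bar> \<le> G' \<omega>"
    "expectation G' \<le> (1/2) ^ J / sqrt (real (card I)) * sqrt (2 * A (Suc J))"
    by blast
  show ?case
  proof (intro exI[of _ "\<lambda>\<omega>. G \<omega> + G' \<omega>"] conjI allI ballI)
    show "integrable M (\<lambda>\<omega>. G \<omega> + G' \<omega>)" using G(1) G'(1) by simp
    show "\<bar>dev I y \<omega> - dev I x0 \<omega>\<bar> \<le> G \<omega> + G' \<omega>" if "y \<in> H (Suc J)" for \<omega> y
      using G(2)[OF \<pi>(1)[of y], of \<omega>] G'(2)[OF that, of \<omega>] by linarith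
    show "expectation (\<lambda>\<omega>. G \<omega> + G' \<omega>)
        \<le> (\<Sum>j = 1..Suc J. 2 * (1/2) ^ j / sqrt (real (card I)) * sqrt (2 * A j))"
      using G(1,3) G'(1,3) by simp
  qed
qed

text \<open>The sample average and the mean payoff contribute one \<open>dist y z\<close>
  each.\<close>

lemma AE_dev_lipschitz: "AE \<omega> in M. \<bar>dev I y \<omega> - dev I z \<omega>\<bar> \<le> 2 * dist y z"
proof -
  have "AE \<omega> in M. \<forall>s\<in>I. \<bar>f s \<omega> y - f s \<omega> z\<bar> \<le> dist y z"
    using I AE_draw_lipschitz by (intro AE_finite_allI) auto
  then show ?thesis
  proof eventually_elim
    case (elim \<omega>)
    have "\<bar>\<Sum>s\<in>I. f s \<omega> y - f s \<omega> z\<bar> \<le> (\<Sum>s\<in>I. \<bar>f s \<omega> y - f s \<omega> z\<bar>)" by (rule sum_abs)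
    also have "\<dots> \<le> (\<Sum>s\<in>I. dist y z)" using elim by (intro sum_mono) auto
    finally have "\<bar>(\<Sum>s\<in>I. f s \<omega> y - f s \<omega> z) / real (card I)\<bar> \<le> dist y z"
      using card_pos by (simp add: field_simps)
    then have "\<bar>(\<Sum>s\<in>I. f s \<omega> y) / real (card I) - (\<Sum>s\<in>I. f s \<omega> z) / real (card I)\<bar> \<le> dist y z"
      by (simp add: sum_subtractf diff_divide_distrib)
    then show ?case using mean_payoff_lipschitz[of y z] unfolding dev_def by linarith
  qed
qed

text \<open>The hitting set costs \<open>\<delta>\<close>. The deviations at the maximizer and at
  its competitor, both measured from \<open>x0\<close>, cost \<open>G\<close> each, and rounding
  each of these two points to the net \<open>H J\<close> costs \<open>2 * (1/2) ^ J\<close>.\<close>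

lemma empirical_maximizer_regret:
  fixes H :: "nat \<Rightarrow> 'a set" and A :: "nat \<Rightarrow> real"
  assumes H0: "H 0 = {x0}"
    and H: "\<And>j. finite (H j)" "\<And>j. hitting_set UNIV ((1/2) ^ j) (H j)"
    and A: "\<And>j. A j > 0" "\<And>j. 2 * real (card (H j)) \<le> exp (A j)"
    and S: "finite S" "hitting_set UNIV \<delta> S"
    and X [measurable]: "X \<in> borel_measurable M"
    and X_max: "\<And>\<omega>. \<omega> \<in> space M \<Longrightarrow>
        is_arg_max (\<lambda>y. (\<Sum>s\<in>I. f s \<omega> y) / real (card I)) (\<lambda>y. y \<in> S) (X \<omega>)"
  shows "(SUP y. mean_payoff P y) - expectation (\<lambda>\<omega>. mean_payoff P (X \<omega>)) \<le> \<delta> + 4 * (1/2) ^ J +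
     2 * (\<Sum>j = 1..J. 2 * (1/2) ^ j / sqrt (real (card I)) * sqrt (2 * A j))"
proof -
  obtain G where G: "integrable M G" "\<And>\<omega> y. y \<in> H J \<Longrightarrow> \<bar>dev I y \<omega> - dev I x0 \<omega>\<bar> \<le> G \<omega>"
    "expectation G \<le> (\<Sum>j = 1..J. 2 * (1/2) ^ j / sqrt (real (card I)) * sqrt (2 * A j))"
    using chaining_majorant[where J = J, OF H0 H A] by blast
  have "\<exists>z\<in>H J. dist z y \<le> (1/2) ^ J" for y
    using hitting_setD[OF H(2)[of J]] by (metis UNIV_I)
  then obtain \<pi> where \<pi>: "\<And>y. \<pi> y \<in> H J" "\<And>y. dist (\<pi> y) y \<le> (1/2) ^ J"
    by metis
  \<comment> \<open>Finiteness of \<open>S\<close> makes the bound simultaneous, hence valid at the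
    random point \<open>X \<omega>\<close>.\<close>
  have "AE \<omega> in M. \<forall>y\<in>S. \<bar>dev I (\<pi> y) \<omega> - dev I y \<omega>\<bar> \<le> 2 * dist (\<pi> y) y"
    using S(1) AE_dev_lipschitz by (intro AE_finite_allI) auto
  with AE_space have ae: "AE \<omega> in M. (SUP y. mean_payoff P y) \<le>
      mean_payoff P (X \<omega>) + (\<delta> + 4 * (1/2) ^ J + 2 * G \<omega>)"
  proof eventually_elim
    case (elim \<omega>)
    have dev_S: "\<bar>dev I y \<omega> - dev I x0 \<omega>\<bar> \<le> G \<omega> + 2 * (1/2) ^ J" if "y \<in> S" for y
      using elim(2) that \<pi>(2)[of y] G(2)[OF \<pi>(1)[of y], of \<omega>] by force
    have XS: "X \<omega> \<in> S"
      and X_ge: "(\<Sum>s\<in>I. f s \<omega> z) / real (card I) \<le> (\<Sum>s\<in>I. f s \<omega> (X \<omega>)) / real (card I)"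
      if "z \<in> S" for z
      using X_max[OF elim(1)] that by (auto simp: is_arg_max_def not_less)
    show ?case
    proof (rule cSUP_least)
      fix y
      obtain z where z: "z \<in> S" "dist z y \<le> \<delta>"
        using hitting_setD[OF S(2) UNIV_I] .
      have "mean_payoff P y \<le> mean_payoff P z + \<delta>"
        using mean_payoff_lipschitz[of z y] z(2) by linarith
      \<comment> \<open>The sample average at \<open>X \<omega>\<close> is at least that at
        \<open>z\<close>, so a gap between the means is paid for by the deviations. Only their
        difference enters, and \<open>dev I x0 \<omega>\<close> cancels.\<close>
      moreover have "mean_payoff P z \<le> mean_payoff P (X \<omega>) + dev I (X \<omega>) \<omega> - dev I z \<omega>"
        using X_ge[OF z(1)] by (simp add: dev_def)
      ultimately show "mean_payoff P y \<le> mean_payoff P (X \<omega>) + (\<delta> + 4 * (1/2) ^ J + 2 * G \<omega>)"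
        using dev_S[OF z(1)] dev_S[OF XS[OF z(1)]] by linarith
    qed simp
  qed
  have int: "integrable M (\<lambda>\<omega>. mean_payoff P (X \<omega>))"
    using mean_payoff_bounds by (intro integrable_const_bound[of _ 1]) auto
  have "(SUP y. mean_payoff P y)
      \<le> expectation (\<lambda>\<omega>. mean_payoff P (X \<omega>) + (\<delta> + 4 * (1/2) ^ J + 2 * G \<omega>))"
    using int G(1) ae by (intro integral_ge_const) auto
  also have "\<dots> = expectation (\<lambda>\<omega>. mean_payoff P (X \<omega>)) + (\<delta> + 4 * (1/2) ^ J + 2 * expectation G)"
    using int G(1) by (simp add: prob_space)
  finally show ?thesis using G(3) by linarith
qed

end

section \<open>Regret over rounds and phases\<close>

lemma regret_eq_sum:
  assumes "\<And>s. s \<ge> 1 \<Longrightarrow> x s \<in> borel_measurable M"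
  shows "regret P M x t =
    (\<Sum>s = 1..t. (SUP y. mean_payoff P y) - expectation (\<lambda>\<omega>. mean_payoff P (x s \<omega>)))"
proof -
  have "integrable M (\<lambda>\<omega>. mean_payoff P (x s \<omega>))" if "s \<ge> 1" for s
    using mean_payoff_bounds measurable_compose[OF assms[OF that] mean_payoff_measurable]
    by (intro integrable_const_bound[of _ 1]) auto
  then show ?thesis
    unfolding regret_def by (subst Bochner_Integration.integral_sum) (auto simp: sum_subtractf)
qed

end

text \<open>Phases are dyadic intervals shifted by one, so \<open>s + 1\<close> is placed between
  powers of 2.\<close>

lemma phase_cover:
  assumes "s \<ge> 1"
  obtains i where "i \<ge> 1" "s \<in> phase i" "s < 2 ^ Suc i"
proof -
  obtain i where i: "2 ^ i \<le> s + 1" "s + 1 < 2 ^ Suc i"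
    using ex_power_ivl1[of 2 "s + 1"] by auto
  moreover have "i \<ge> 1" using i assms by (cases i) auto
  moreover have "s \<in> phase i" using i by (auto simp: phase_def)
  ultimately show ?thesis using that[of i] by simp
qed

theorem theorem9p2:
  fixes b :: real
  assumes "bounded (UNIV :: 'a::metric_space set)" and "diameter (UNIV :: 'a set) \<le> 1"
    and "LCD (UNIV :: 'a set) < ereal b" and "b \<ge> 2"
  shows "\<exists>C. \<forall>(P :: ('a \<Rightarrow> real) measure) (M :: 'w measure) f x.
           experts_instance P \<and> uniformly_lipschitz P \<and> iid_payoffs P M f \<and> naive_exp (b - 2) M f x
           \<longrightarrow> (\<forall>t\<ge>1. regret P M x t \<le> C * real t powr (1 - 1 / b))"
proof -
  obtain \<beta> K where \<beta>: "\<beta> < b" and K: "K > 0" and cov: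
    "\<And>r. 0 < r \<Longrightarrow> r \<le> 1 \<Longrightarrow>
      \<exists>n. covering_number (UNIV :: 'a set) r = enat n \<and> 2 * real n \<le> exp (K * r powr - \<beta>)"
    using LCD_less_imp_covering_number_le[OF assms(3)] assms(4) by auto
  define x0 :: 'a where "x0 = undefined"
  \<comment> \<open>The summand 1 in \<open>K + 1\<close> gives \<open>exp (A 0) \<ge> 2\<close>, as
    the one-point net \<open>{x0}\<close> requires; that net has radius 1 because the diameter is at
    most 1.\<close>
  define A where "A j = (K + 1) * 2 powr (real j * \<beta>)" for j :: nat
  have A: "A j > 0" for j using K by (simp add: A_def)
  have "\<exists>S :: 'a set. finite S \<and> hitting_set UNIV ((1/2) ^ j) S \<and> 2 * real (card S) \<le> exp (A j)
      \<and> (j = 0 \<longrightarrow> S = {x0})" for j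
  proof (cases "j = 0")
    case True
    have "dist x0 y \<le> 1" for y
      using diameter_bounded_bound[OF assms(1), of x0 y] assms(2) by auto
    moreover have "2 \<le> exp (A j)"
      using exp_ge_add_one_self[of "A j"] K True by (simp add: A_def)
    ultimately show ?thesis using True
      by (intro exI[of _ "{x0}"]) (auto simp: hitting_set_def)
  next
    case False
    have r: "(1/2::real) ^ j = 2 powr - real j"
      by (simp add: powr_minus powr_realpow power_divide inverse_eq_divide)
    obtain n where n: "covering_number (UNIV :: 'a set) ((1/2) ^ j) = enat n"
      "2 * real n \<le> exp (K * ((1/2) ^ j) powr - \<beta>)"
      using cov[of "(1/2) ^ j"] by (auto simp: power_le_one)
    obtain S :: "'a set" where S: "finite S" "hitting_set UNIV ((1/2) ^ j) S" "card S \<le> n"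
      using hitting_set_exists[of "UNIV :: 'a set" "(1/2) ^ j"] n(1) by auto
    have "2 * real (card S) \<le> 2 * real n" using S(3) by simp
    also note n(2)
    also have "exp (K * ((1/2) ^ j) powr - \<beta>) \<le> exp (A j)"
      unfolding r by (simp add: A_def powr_powr algebra_simps)
    finally show ?thesis using S False by blast
  qed
  then obtain H :: "nat \<Rightarrow> 'a set" where H: "\<And>j. finite (H j)" "\<And>j. hitting_set UNIV ((1/2) ^ j) (H j)"
    "\<And>j. 2 * real (card (H j)) \<le> exp (A j)" "H 0 = {x0}"
    by metis
  define D where "D = 2 powr (b / 2 - 1) / (1 - 2 powr (- (b - \<beta>) / 2))"
  have D: "D > 0" using assms(4) \<beta> by (auto simp: D_def powr_less_one)
  \<comment> \<open>The 5 is 1 for the hitting set plus 4 for rounding to the net. The other 4 is 2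
    for the two deviations times 2 for the radius of the links.\<close>
  define C where "C = 5 + 4 * sqrt (2 * (K + 1)) * D"
  have C: "C \<ge> 1" using D K by (simp add: C_def)
  show ?thesis
  proof (intro exI[of _ "8 * C"] allI impI, elim conjE)
    fix P :: "('a \<Rightarrow> real) measure" and M :: "'w measure" and f x and t :: nat
    assume "experts_instance P" "uniformly_lipschitz P" "iid_payoffs P M f"
      and naive: "naive_exp (b - 2) M f x" and t: "t \<ge> 1"
    then interpret lipschitz_experts P M f by unfold_locales
    have xm: "x s \<in> borel_measurable M" if "s \<ge> 1" for s
      using naive that by (simp add: naive_exp_def)
    from naive obtain S xstar where
      S': "\<forall>i\<ge>1. finite (S i) \<and> hitting_set UNIV ((2 ^ i) powr (- 1 / b)) (S i) \<and>
           enat (card (S i)) \<le> covering_number (UNIV :: 'a set) ((2 ^ i) powr (- 1 / b))"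
      and xstar: "\<forall>i\<ge>1. \<forall>\<omega>\<in>space M.
           is_arg_max (\<lambda>y. (\<Sum>s\<in>phase i. f s \<omega> y) / 2 ^ i) (\<lambda>y. y \<in> S i) (xstar i \<omega>) \<and>
           (\<forall>s\<in>phase (i + 1). x s \<omega> = xstar i \<omega>)"
      \<comment> \<open>The exponent parameter is \<open>b - 2 + 2\<close>, hence
        \<open>\<delta>\<close> in phase \<open>i\<close> is
        \<open>(2 ^ i) powr (- 1 / b)\<close>.\<close>
      unfolding naive_exp_def Let_def diff_add_cancel by (elim conjE exE) rule
    have S: "finite (S i)" "hitting_set UNIV ((2 ^ i) powr (- 1 / b)) (S i)" if "i \<ge> 1" for i
      using S' that by blast+
    have argmax: "is_arg_max (\<lambda>y. (\<Sum>s\<in>phase i. f s \<omega> y) / 2 ^ i) (\<lambda>y. y \<in> S i) (xstar i \<omega>)"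
      and play: "s \<in> phase (i + 1) \<Longrightarrow> x s \<omega> = xstar i \<omega>"
      if "i \<ge> 1" "\<omega> \<in> space M" for i \<omega> s
      using xstar that by blast+
    let ?r = "\<lambda>s. (SUP y. mean_payoff P y) - expectation (\<lambda>\<omega>. mean_payoff P (x s \<omega>))"
    have round: "?r s \<le> C * 2 powr (- real i / b)" if i: "i \<ge> 1" and s: "s \<in> phase (i + 1)" for i s
    proof -
      \<comment> \<open>The chain stops at the first net whose radius is at most the
        \<open>\<delta>\<close> of phase \<open>i\<close>.\<close>
      define J where "J = nat \<lceil>real i / b\<rceil>"
      have "(2::nat) ^ i \<ge> 2 ^ 1" using i by (intro power_increasing) auto
      then have ph: "finite (phase i)" "phase i \<noteq> {}" "phase i \<subseteq> {1..}"
        by (auto simp: phase_def)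
      have card: "real (card (phase i)) = 2 ^ i" by (simp add: phase_def)
      have "1 \<le> (2::nat) ^ i" by simp
      then have s1: "s \<ge> 1" using s
        unfolding phase_def atLeastLessThan_iff power_add power_one_right by arith
      have x_max: "is_arg_max (\<lambda>y. (\<Sum>s\<in>phase i. f s \<omega> y) / real (card (phase i))) (\<lambda>y. y \<in> S i) (x s \<omega>)"
        if "\<omega> \<in> space M" for \<omega>
        unfolding card play[OF i that s] by (rule argmax[OF i that])
      have "?r s \<le> (2 ^ i) powr (- 1 / b) + 4 * (1/2) ^ J
        + 2 * (\<Sum>j = 1..J. 2 * (1/2) ^ j / sqrt (real (card (phase i))) * sqrt (2 * A j))"
        by (rule empirical_maximizer_regret[OF ph H(4,1,2) A H(3) S[OF i] xm[OF s1] x_max])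
      also have "(2 ^ i) powr (- 1 / b) = 2 powr (- real i / b)"
        by (simp add: powr_powr flip: powr_realpow)
      also have "(\<Sum>j = 1..J. 2 * (1/2) ^ j / sqrt (real (card (phase i))) * sqrt (2 * A j))
        = 2 * sqrt (2 * (K + 1)) * ((\<Sum>j = 1..J. 2 powr (real j * (\<beta> / 2 - 1))) * 2 powr (- real i / 2))"
      proof -
        have "2 * (1/2) ^ j / sqrt (real (card (phase i))) * sqrt (2 * A j)
          = 2 * sqrt (2 * (K + 1)) * (2 powr (real j * (\<beta> / 2 - 1)) * 2 powr (- real i / 2))" for j
        proof -
          have e1: "sqrt (2 ^ i) = 2 powr (real i / 2)"
            by (simp add: powr_powr flip: powr_half_sqrt powr_realpow)
          have e2: "sqrt (2 * A j) = sqrt (2 * (K + 1)) * 2 powr (real j * \<beta> / 2)"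
          proof -
            have "sqrt (2 powr (real j * \<beta>)) = 2 powr (real j * \<beta> / 2)"
              by (simp add: powr_powr flip: powr_half_sqrt)
            then show ?thesis unfolding A_def mult.assoc[symmetric] by (simp only: real_sqrt_mult)
          qed
          have e3: "(1/2::real) ^ j = 2 powr - real j"
            by (simp add: powr_minus powr_realpow power_divide inverse_eq_divide)
          have "2 powr - real j / 2 powr (real i / 2) * 2 powr (real j * \<beta> / 2)
            = 2 powr (real j * (\<beta> / 2 - 1)) * (2::real) powr (- real i / 2)"
            by (simp add: algebra_simps flip: powr_add powr_diff)
          then show ?thesis unfolding card e1 e2 e3 by (simp add: field_simps)
        qed
        then show ?thesis by (simp add: sum_distrib_left sum_distrib_right)
      qed
      also have "(1/2::real) ^ J \<le> 2 powr (- real i / b)"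
      proof -
        have "real i / b \<le> real J" using assms(4) by (simp add: J_def of_nat_ceiling)
        then have "(2::real) powr - real J \<le> 2 powr (- real i / b)" by (intro powr_mono) auto
        then show ?thesis by (simp add: powr_minus powr_realpow power_divide inverse_eq_divide)
      qed
      also have "(\<Sum>j = 1..J. 2 powr (real j * (\<beta> / 2 - 1))) * 2 powr (- real i / 2)
          \<le> D * 2 powr (- real i / b)"
        unfolding J_def D_def by (rule dudley_sum_le[OF \<beta> assms(4)])
      finally show ?thesis using K by (simp add: C_def algebra_simps mult_left_mono)
    qed
    have r_le: "?r s \<le> 4 * C * real s powr - (1 / b)" if s: "s \<ge> 1" for s
    proof -
      obtain i where i: "i \<ge> 1" "s \<in> phase i" "s < 2 ^ Suc i" using phase_cover[OF s] .
      have "?r s \<le> C * 2 powr (- real (i - 1) / b)"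
      \<comment> \<open>Phase 1 has no earlier data; there the regret of a round is at most 1, and
        \<open>C \<ge> 1\<close> suffices.\<close>
      proof (cases "i = 1")
        case True
        have "(SUP y. mean_payoff P y) \<le> 1" using mean_payoff_bounds by (intro cSUP_least) auto
        moreover have "0 \<le> expectation (\<lambda>\<omega>. mean_payoff P (x s \<omega>))"
          using mean_payoff_bounds by (intro integral_nonneg_AE) auto
        ultimately show ?thesis using C True by simp
      next
        case False
        then show ?thesis using round[of "i - 1" s] i by simp
      qed
      \<comment> \<open>The data come from phase \<open>i - 1\<close>, while \<open>s\<close> may be
        close to \<open>2 ^ (i + 1)\<close>. The two missing doublings cost
        \<open>2 powr (2 / b) \<le> 4\<close>.\<close>
      also have "2 powr (- real (i - 1) / b) \<le> 4 * real s powr - (1 / b)"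
      proof -
        have "real s \<le> 2 powr (real i + 1)"
        proof -
          have "real s \<le> real (2 ^ Suc i)" using i(3) by (simp only: of_nat_le_iff less_imp_le)
          then show ?thesis by (simp add: powr_add powr_realpow)
        qed
        then have "(2 powr (real i + 1)) powr - (1 / b) \<le> real s powr - (1 / b)"
          using s assms(4) by (intro powr_mono2') auto
        moreover have "(2::real) powr (- real (i - 1) / b) = 2 powr (2 / b) * (2 powr (real i + 1)) powr - (1 / b)"
        proof -
          have "- real (i - 1) / b = 2 / b + (real i + 1) * - (1 / b)"
            using i(1) assms(4) by (simp add: of_nat_diff field_simps)
          then show ?thesis by (simp only: powr_powr flip: powr_add)
        qed
        moreover have "(2::real) powr (2 / b) \<le> 2 powr 2" using assms(4) by (intro powr_mono) (auto simp: field_simps)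
        ultimately show ?thesis by (simp add: mult_mono)
      qed
      finally show ?thesis using C by (simp add: mult_left_mono)
    qed
    have "regret P M x t = (\<Sum>s = 1..t. ?r s)" by (rule regret_eq_sum[OF xm])
    also have "\<dots> \<le> (\<Sum>s = 1..t. 4 * C * real s powr - (1 / b))"
      using r_le by (intro sum_mono) auto
    also have "\<dots> = 4 * C * (\<Sum>s = 1..t. real s powr - (1 / b))" by (simp add: sum_distrib_left)
    also have "\<dots> \<le> 4 * C * (2 * real t powr (1 - 1 / b))"
      using C assms(4) by (intro mult_left_mono sum_powr_minus_le) (auto simp: field_simps)
    finally show "regret P M x t \<le> 8 * C * real t powr (1 - 1 / b)" by simp
  qed
qed

end
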